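(* Let $(X,d)$ be a Hadamard space and let $f:X\times X\to\mathbb{R}$ be a bifunction such that: (1) $f(x,x)=0$ for all $x\in X$; (2) for every $x\in X$ the function $f(x,\cdot)$ is lower semicontinuous, and for every $y\in X$ the function $f(\cdot,y)$ is upper semicontinuous; (3) $f$ is pseudomonotone, i.e. for all $x,y\in X$, $f(x,y)\ge 0$ implies $f(y,x)\le 0$; (4) there is $\gamma>0$ such that for every $x\in X$ the function $f(x,\cdot)$ is strongly quasiconvex with modulus $\gamma$. Then the solution set $S(f)=\{x^*\in X \mid f(x^*,y)\ge 0 \text{ for all } y\in X\}$ is nonempty.
   Context: A Hadamard space is a (nonempty) complete CAT(0) space, i.e. a complete geodesic metric space $(X,d)$ such that $d^2(\gamma(\lambda l),x)\le(1-\lambda)d^2(\gamma(0),x)+\lambda d^2(\gamma(l),x)-\lambda(1-\lambda)d^2(\gamma(0),\gamma(l))$ for all $x\in X$, $\lambda\in[0,1]$ and all geodesics $\gamma:[0,l]\to X$. Such a space is uniquely geodesic, and $(1-\lambda)x\oplus\lambda y$ denotes the point at distance $\lambda d(x,y)$ from $x$ on the unique geodesic joining $x$ to $y$. A function $h:X\to\mathbb{R}$ is strongly quasiconvex with modulus $\gamma>0$ if $h((1-\lambda)x\oplus\lambda y)\le\max\{h(x),h(y)\}-\lambda(1-\lambda)\frac{\gamma}{2}d^2(x,y)$ for all $x,y\in X$, $\lambda\in[0,1]$. Lower/upper semicontinuity is with respect to the metric. *)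

theory Defs
  imports "HOL-Analysis.Analysis"
begin

text \<open>A unit-speed geodesic \<open>[0,l] \<rightarrow> X\<close>; values of \<open>g\<close> outside \<open>[0,l]\<close> are irrelevant.\<close>

definition geodesic :: "real \<Rightarrow> (real \<Rightarrow> 'a::metric_space) \<Rightarrow> bool" where
  "geodesic l g \<longleftrightarrow> 0 \<le> l \<and> (\<forall>s\<in>{0..l}. \<forall>t\<in>{0..l}. dist (g s) (g t) = \<bar>s - t\<bar>)"

definition geodesic_between :: "'a::metric_space \<Rightarrow> 'a \<Rightarrow> (real \<Rightarrow> 'a) \<Rightarrow> bool" where
  "geodesic_between x y g \<longleftrightarrow> geodesic (dist x y) g \<and> g 0 = x \<and> g (dist x y) = y"

class hadamard_space = complete_space +
  assumes geodesic_exists: "\<exists>g. geodesic_between x y g"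
    and CAT0_inequality: "geodesic l g \<Longrightarrow> 0 \<le> t \<Longrightarrow> t \<le> 1 \<Longrightarrow>
      (dist (g (t * l)) x)\<^sup>2
        \<le> (1 - t) * (dist (g 0) x)\<^sup>2 + t * (dist (g l) x)\<^sup>2 - t * (1 - t) * (dist (g 0) (g l))\<^sup>2"

text \<open>\<open>geodesic_comb t x y\<close> is the point \<open>(1 - t) x \<oplus> t y\<close>. It is meaningful for
  \<open>0 \<le> t \<le> 1\<close>, where it is well defined by \<open>geodesic_comb_eq\<close> below.\<close>

definition geodesic_comb :: "real \<Rightarrow> 'a::hadamard_space \<Rightarrow> 'a \<Rightarrow> 'a" where
  "geodesic_comb t x y = (THE z. \<exists>g. geodesic_between x y g \<and> z = g (t * dist x y))"

definition lower_semicontinuous :: "('a::topological_space \<Rightarrow> real) \<Rightarrow> bool" where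
  "lower_semicontinuous h \<longleftrightarrow> (\<forall>x. \<forall>c < h x. \<forall>\<^sub>F z in nhds x. c < h z)"

definition upper_semicontinuous :: "('a::topological_space \<Rightarrow> real) \<Rightarrow> bool" where
  "upper_semicontinuous h \<longleftrightarrow> (\<forall>x. \<forall>c > h x. \<forall>\<^sub>F z in nhds x. h z < c)"

definition strongly_quasiconvex :: "real \<Rightarrow> ('a::hadamard_space \<Rightarrow> real) \<Rightarrow> bool" where
  "strongly_quasiconvex \<gamma> h \<longleftrightarrow> 0 < \<gamma> \<and>
    (\<forall>x y. \<forall>t\<in>{0..1}. h (geodesic_comb t x y)
      \<le> max (h x) (h y) - t * (1 - t) * (\<gamma> / 2) * (dist x y)\<^sup>2)"

definition pseudomonotone :: "('a \<Rightarrow> 'a \<Rightarrow> real) \<Rightarrow> bool" where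
  "pseudomonotone f \<longleftrightarrow> (\<forall>x y. 0 \<le> f x y \<longrightarrow> f y x \<le> 0)"

definition equilibrium_solutions :: "('a \<Rightarrow> 'a \<Rightarrow> real) \<Rightarrow> 'a set" where
  "equilibrium_solutions f = {x. \<forall>y. 0 \<le> f x y}"

lemma geodesic_between_unique:
  fixes x y :: "'a::hadamard_space"
  assumes g: "geodesic_between x y g" and k: "geodesic_between x y k" and t: "0 \<le> t" "t \<le> 1"
  shows "g (t * dist x y) = k (t * dist x y)"
proof -
  let ?l = "dist x y"
  have mem: "0 \<in> {0..?l}" "?l \<in> {0..?l}" "t * ?l \<in> {0..?l}"
    using t by (auto simp: mult_left_le_one_le)
  have geo: "geodesic ?l g" "geodesic ?l k" and ends: "g 0 = x" "g ?l = y" "k 0 = x" "k ?l = y"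
    using g k by (auto simp: geodesic_between_def)
  have d0: "dist x (k (t * ?l)) = \<bar>0 - t * ?l\<bar>"
    using geo(2) mem ends(3,4) unfolding geodesic_def by metis
  have d1: "dist y (k (t * ?l)) = \<bar>?l - t * ?l\<bar>"
    using geo(2) mem ends(3,4) unfolding geodesic_def by metis
  have "(dist (g (t * ?l)) (k (t * ?l)))\<^sup>2
      \<le> (1 - t) * \<bar>0 - t * ?l\<bar>\<^sup>2 + t * \<bar>?l - t * ?l\<bar>\<^sup>2 - t * (1 - t) * ?l\<^sup>2"
    using CAT0_inequality[OF geo(1) t, of "k (t * ?l)"] ends d0 d1 by simp
  also have "\<dots> = 0"
    unfolding power2_abs by algebra
  finally show ?thesis by simp
qed

lemma geodesic_comb_eq:
  fixes x y :: "'a::hadamard_space"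
  assumes "geodesic_between x y g" "0 \<le> t" "t \<le> 1"
  shows "geodesic_comb t x y = g (t * dist x y)"
  unfolding geodesic_comb_def
  using assms geodesic_between_unique by (intro the_equality) blast+

end

theory Submission
  imports Defs
begin

text \<open>
  By pseudomonotonicity it is enough to find a point common to all sets
  \<open>D y = {x. f y x \<le> 0}\<close>: on the segment from such a point \<open>x\<close> to \<open>y\<close>, strong quasiconvexity
  gives \<open>f z y > 0\<close> for all interior \<open>z\<close>, whence \<open>f x y \<ge> 0\<close> by upper semicontinuity
  as \<open>z\<close> tends to \<open>x\<close>. The sets \<open>D y\<close> are closed, bounded and geodesically convex, so by the weak
  compactness of Hadamard spaces it remains to intersect finitely many of them.
  For \<open>y\<^sub>0, \<dots>, y\<^sub>n\<close>, parametrise iterated geodesic combinations \<open>w\<close> of the \<open>y\<^sub>i\<close> by a cube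
  and apply the Poincare-Miranda theorem to the distances \<open>g\<^sub>i\<close> from \<open>w\<close> to \<open>D y\<^sub>i\<close>, so as to make
  the \<open>g\<^sub>i\<close> proportional to the barycentric weights of \<open>w\<close>. If they do not all vanish, then \<open>w\<close> is
  a combination of points \<open>y\<^sub>i\<close> with \<open>f y\<^sub>i w > 0\<close>, hence with \<open>f w y\<^sub>i < 0\<close>,
  and quasiconvexity yields the contradiction \<open>f w w < 0\<close>.
\<close>

section \<open>The Poincare-Miranda theorem\<close>

lemma tendsto_fun_iff:
  fixes X :: "'b \<Rightarrow> 'i \<Rightarrow> 'a::topological_space"
  shows "(X \<longlongrightarrow> L) F \<longleftrightarrow> (\<forall>i. ((\<lambda>b. X b i) \<longlongrightarrow> L i) F)"
proof -
  have "limitin euclidean X L F \<longleftrightarrow> (\<forall>i. limitin euclidean (\<lambda>b. X b i) (L i) F)"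
    unfolding euclidean_product_topology[symmetric] limitin_componentwise by simp
  then show ?thesis by simp
qed

text \<open>Every coordinate is constrained, so the cube is a full product in the topology of
  pointwise convergence and Tychonoff's theorem makes it compact. The dimension \<open>n\<close>
  enters only through the functions considered on it.\<close>

definition unit_cube :: "('i \<Rightarrow> real) set" where
  "unit_cube = {t. \<forall>i. t i \<in> {0..1}}"

lemma compact_unit_cube: "compact unit_cube"
proof -
  have "compactin (product_topology (\<lambda>i. euclidean) UNIV) (PiE UNIV (\<lambda>i::'a. {0..1::real}))"
    unfolding compactin_PiE by simp
  moreover have "PiE UNIV (\<lambda>i::'a. {0..1::real}) = unit_cube"
    by (auto simp: unit_cube_def PiE_def Pi_def)
  ultimately show ?thesis
    by (simp add: euclidean_product_topology)
qed

text \<open>Kuhn's combinatorial lemma, with the signs of the \<open>F i\<close> as labels on a grid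
  of mesh \<open>1 / Suc m\<close>, yields a cell on whose vertices every \<open>F i\<close> takes
  both signs (in the weak sense). These cells accumulate at a point of the compact cube, where
  continuity forces all \<open>F i\<close> to vanish.\<close>

theorem Poincare_Miranda:
  fixes F :: "nat \<Rightarrow> (nat \<Rightarrow> real) \<Rightarrow> real"
  assumes cont: "\<And>i. i < n \<Longrightarrow> continuous_on unit_cube (F i)"
    and le: "\<And>i t. i < n \<Longrightarrow> t \<in> unit_cube \<Longrightarrow> t i = 0 \<Longrightarrow> F i t \<le> 0"
    and ge: "\<And>i t. i < n \<Longrightarrow> t \<in> unit_cube \<Longrightarrow> t i = 1 \<Longrightarrow> F i t \<ge> 0"
  obtains t where "t \<in> unit_cube" "\<And>i. i < n \<Longrightarrow> F i t = 0"
proof -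
  \<comment> \<open>Kuhn's lemma controls only the coordinates below \<open>n\<close>; the others
    are frozen at 0.\<close>
  define pt where "pt m x i = (if i < n then real (x i) / real (Suc m) else 0)"
    for m :: nat and x :: "nat \<Rightarrow> nat" and i
  \<comment> \<open>On the faces the label is the one that Kuhn's lemma demands; the boundary
    hypotheses on \<open>F i\<close> keep it consistent with the sign there.\<close>
  define lab where "lab m x i = (if x i = 0 then 0 else if x i = Suc m then 1
      else if F i (pt m x) \<le> 0 then 0 else (1::nat))" for m x i
  have pt_cube: "pt m x \<in> unit_cube" if "\<And>i. i < n \<Longrightarrow> x i \<le> Suc m" for m x
    using that by (force simp: pt_def unit_cube_def simp flip: of_nat_Suc)
  have lab0: "F i (pt m x) \<le> 0" if "lab m x i = 0" "\<And>i. i < n \<Longrightarrow> x i \<le> Suc m" "i < n" for m x i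
    using that le[OF \<open>i < n\<close> pt_cube[OF that(2)]]
    by (auto simp: lab_def pt_def[of _ _ i] split: if_splits)
  have lab1: "F i (pt m x) \<ge> 0" if "lab m x i \<noteq> 0" "\<And>i. i < n \<Longrightarrow> x i \<le> Suc m" "i < n" for m x i
    using that ge[OF \<open>i < n\<close> pt_cube[OF that(2)]]
    by (auto simp: lab_def pt_def[of _ _ i] split: if_splits)
  have "\<exists>q. (\<forall>i<n. q i < Suc m) \<and> (\<forall>i<n. \<exists>a b.
      (\<forall>j<n. q j \<le> a j \<and> a j \<le> q j + 1) \<and> (\<forall>j<n. q j \<le> b j \<and> b j \<le> q j + 1) \<and>
      F i (pt m a) \<le> 0 \<and> F i (pt m b) \<ge> 0)" for m
  proof -
    have lab: "\<forall>x. (\<forall>i<n. x i \<le> Suc m) \<longrightarrow> (\<forall>i<n. lab m x i = 0 \<or> lab m x i = 1)"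
      "\<forall>x. (\<forall>i<n. x i \<le> Suc m) \<longrightarrow> (\<forall>i<n. x i = 0 \<longrightarrow> lab m x i = 0)"
      "\<forall>x. (\<forall>i<n. x i \<le> Suc m) \<longrightarrow> (\<forall>i<n. x i = Suc m \<longrightarrow> lab m x i = 1)"
      by (simp_all add: lab_def)
    obtain q where q: "\<forall>i<n. q i < Suc m"
      "\<forall>i<n. \<exists>r s. (\<forall>j<n. q j \<le> r j \<and> r j \<le> q j + 1) \<and> (\<forall>j<n. q j \<le> s j \<and> s j \<le> q j + 1)
        \<and> lab m r i \<noteq> lab m s i"
      by (rule kuhn_lemma[OF zero_less_Suc lab])
    have "\<exists>a b. (\<forall>j<n. q j \<le> a j \<and> a j \<le> q j + 1) \<and> (\<forall>j<n. q j \<le> b j \<and> b j \<le> q j + 1) \<and>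
      F i (pt m a) \<le> 0 \<and> F i (pt m b) \<ge> 0" if i: "i < n" for i
    proof -
      obtain r s where rs: "\<forall>j<n. q j \<le> r j \<and> r j \<le> q j + 1" "\<forall>j<n. q j \<le> s j \<and> s j \<le> q j + 1"
        "lab m r i \<noteq> lab m s i"
        using q(2) i by blast
      have b: "r j \<le> Suc m" "s j \<le> Suc m" if "j < n" for j
        using q(1) rs(1,2) that by fastforce+
      show ?thesis
      proof (cases "lab m r i = 0")
        case True
        then show ?thesis using rs lab0[of m r i, OF _ b(1) i] lab1[of m s i, OF _ b(2) i] by auto
      next
        case False
        then have "lab m s i = 0" using rs(3) by (auto simp: lab_def split: if_splits)
        then show ?thesis using False rs lab0[of m s i, OF _ b(2) i] lab1[of m r i, OF _ b(1) i] by auto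
      qed
    qed
    with q(1) show ?thesis by blast
  qed
  then obtain q where q: "\<And>m i. i < n \<Longrightarrow> q m i < Suc m"
    and "\<And>m. \<forall>i<n. \<exists>a b.
      (\<forall>j<n. q m j \<le> a j \<and> a j \<le> q m j + 1) \<and> (\<forall>j<n. q m j \<le> b j \<and> b j \<le> q m j + 1) \<and>
      F i (pt m a) \<le> 0 \<and> F i (pt m b) \<ge> 0"
    by metis
  then obtain a b where
      a: "\<And>m i j. i < n \<Longrightarrow> j < n \<Longrightarrow> q m j \<le> a m i j \<and> a m i j \<le> q m j + 1"
    and b: "\<And>m i j. i < n \<Longrightarrow> j < n \<Longrightarrow> q m j \<le> b m i j \<and> b m i j \<le> q m j + 1"
    and Fa: "\<And>m i. i < n \<Longrightarrow> F i (pt m (a m i)) \<le> 0"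
    and Fb: "\<And>m i. i < n \<Longrightarrow> F i (pt m (b m i)) \<ge> 0"
    by metis
  have "\<forall>m. pt m (q m) \<in> unit_cube"
    using pt_cube q by (simp add: less_imp_le)
  then obtain t r where t: "t \<in> unit_cube" and r: "strict_mono r"
    and lim: "((\<lambda>m. pt m (q m)) \<circ> r) \<longlonglongrightarrow> t"
    by (rule seq_compactE[OF compact_imp_seq_compact[OF compact_unit_cube]])
  \<comment> \<open>Vertices of the \<open>m\<close>-th cell differ from its corner
    \<open>q m\<close> by at most the mesh in each coordinate, so any choice of vertices has the
    same limit \<open>t\<close>.\<close>
  have close: "(\<lambda>m. pt (r m) (c (r m))) \<longlonglongrightarrow> t"
    if c: "\<And>m j. j < n \<Longrightarrow> q m j \<le> c m j \<and> c m j \<le> q m j + 1" for c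
    unfolding tendsto_fun_iff
  proof
    fix j
    have 1: "(\<lambda>m. pt (r m) (q (r m)) j) \<longlonglongrightarrow> t j"
      using lim unfolding tendsto_fun_iff o_def by blast
    have "norm (pt (r m) (c (r m)) j - pt (r m) (q (r m)) j) \<le> inverse (real (Suc m))" for m
    proof (cases "j < n")
      case True
      have "\<bar>real (c (r m) j) - real (q (r m) j)\<bar> \<le> 1" using c[OF True, of "r m"] by auto
      then have "norm (pt (r m) (c (r m)) j - pt (r m) (q (r m)) j) \<le> inverse (real (Suc (r m)))"
        using True by (simp add: pt_def diff_divide_distrib[symmetric] inverse_eq_divide
            divide_right_mono del: of_nat_Suc)
      also have "\<dots> \<le> inverse (real (Suc m))"
        using seq_suble[OF r, of m] by (intro le_imp_inverse_le) auto
      finally show ?thesis .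
    qed (simp add: pt_def)
    then have "(\<lambda>m. pt (r m) (c (r m)) j - pt (r m) (q (r m)) j) \<longlonglongrightarrow> 0"
      by (intro Lim_null_comparison[OF _ LIMSEQ_inverse_real_of_nat] always_eventually) blast
    from tendsto_add[OF this 1] show "(\<lambda>m. pt (r m) (c (r m)) j) \<longlonglongrightarrow> t j" by simp
  qed
  have F_lim: "(\<lambda>m. F i (pt (r m) (c (r m)))) \<longlonglongrightarrow> F i t"
    if "i < n" and c: "\<And>m j. j < n \<Longrightarrow> q m j \<le> c m j \<and> c m j \<le> q m j + 1" for i c
  proof -
    have "c m j \<le> Suc m" if "j < n" for m j
      using q[OF that, of m] c[OF that, of m] by linarith
    then show ?thesis
      by (intro continuous_on_tendsto_compose[OF cont[OF \<open>i < n\<close>] close[OF c] t]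
          always_eventually allI pt_cube)
  qed
  have "F i t = 0" if i: "i < n" for i
  proof (rule antisym)
    show "F i t \<le> 0"
      by (rule LIMSEQ_le_const2[OF F_lim[where c = "\<lambda>m. a m i", OF i]])
        (use a[OF i] Fa[OF i] in blast)+
    show "F i t \<ge> 0"
      by (rule LIMSEQ_le_const[OF F_lim[where c = "\<lambda>m. b m i", OF i]])
        (use b[OF i] Fb[OF i] in blast)+
  qed
  with t that show thesis by blast
qed

section \<open>Geodesic combinations\<close>

lemma CAT0_geodesic_comb:
  fixes x y z :: "'a::hadamard_space"
  assumes "0 \<le> t" "t \<le> 1"
  shows "(dist (geodesic_comb t x y) z)\<^sup>2
    \<le> (1 - t) * (dist x z)\<^sup>2 + t * (dist y z)\<^sup>2 - t * (1 - t) * (dist x y)\<^sup>2"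
proof -
  obtain g where g: "geodesic_between x y g" using geodesic_exists by blast
  then show ?thesis
    using CAT0_inequality[of "dist x y" g t z] assms geodesic_comb_eq[OF g assms]
    by (auto simp: geodesic_between_def)
qed

lemma dist_geodesic_comb_geodesic_comb:
  fixes x y :: "'a::hadamard_space"
  assumes "0 \<le> s" "s \<le> 1" "0 \<le> t" "t \<le> 1"
  shows "dist (geodesic_comb s x y) (geodesic_comb t x y) = \<bar>s - t\<bar> * dist x y"
proof -
  obtain g where g: "geodesic_between x y g" using geodesic_exists by blast
  have "s * dist x y \<in> {0..dist x y}" "t * dist x y \<in> {0..dist x y}"
    using assms by (auto simp: mult_left_le_one_le)
  then have "dist (g (s * dist x y)) (g (t * dist x y)) = \<bar>s * dist x y - t * dist x y\<bar>"
    using g by (auto simp: geodesic_between_def geodesic_def)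
  then show ?thesis
    using geodesic_comb_eq[OF g] assms by (simp add: left_diff_distrib[symmetric] abs_mult)
qed

lemma geodesic_comb_0 [simp]: "geodesic_comb 0 x y = x"
  using geodesic_exists[of x y] geodesic_comb_eq[of x y _ 0] by (auto simp: geodesic_between_def)

lemma geodesic_comb_1 [simp]: "geodesic_comb 1 x y = y"
  using geodesic_exists[of x y] geodesic_comb_eq[of x y _ 1] by (auto simp: geodesic_between_def)

lemma dist_geodesic_comb_left:
  "0 \<le> t \<Longrightarrow> t \<le> 1 \<Longrightarrow> dist x (geodesic_comb t x y) = t * dist x y"
  using dist_geodesic_comb_geodesic_comb[of 0 t x y] by simp

lemma dist_geodesic_comb_right:
  "0 \<le> t \<Longrightarrow> t \<le> 1 \<Longrightarrow> dist y (geodesic_comb t x y) = (1 - t) * dist x y"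
  using dist_geodesic_comb_geodesic_comb[of 1 t x y] by simp

text \<open>Two uses of the CAT(0) inequality: first on the segment from \<open>a\<close> to
  \<open>y\<close>, seen from \<open>?z\<close>, then on the segment from \<open>b\<close> to
  \<open>y\<close>, seen from \<open>a\<close>. The terms in \<open>dist a y\<close> and
  \<open>dist b y\<close> cancel.\<close>

lemma dist_geodesic_comb_same_end:
  fixes a b y :: "'a::hadamard_space"
  assumes t: "0 \<le> t" "t \<le> 1"
  shows "dist (geodesic_comb t a y) (geodesic_comb t b y) \<le> (1 - t) * dist a b"
proof -
  let ?z = "geodesic_comb t b y"
  have "(dist (geodesic_comb t a y) ?z)\<^sup>2
      \<le> (1 - t) * (dist a ?z)\<^sup>2 + t * ((1 - t) * dist b y)\<^sup>2 - t * (1 - t) * (dist a y)\<^sup>2"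
    using CAT0_geodesic_comb[OF t, of a y ?z] by (simp add: dist_geodesic_comb_right t)
  also have "(1 - t) * (dist a ?z)\<^sup>2
      \<le> (1 - t) * ((1 - t) * (dist a b)\<^sup>2 + t * (dist a y)\<^sup>2 - t * (1 - t) * (dist b y)\<^sup>2)"
    using CAT0_geodesic_comb[OF t, of b y a] t
    by (intro mult_left_mono) (simp_all add: dist_commute)
  also have "(1 - t) * ((1 - t) * (dist a b)\<^sup>2 + t * (dist a y)\<^sup>2 - t * (1 - t) * (dist b y)\<^sup>2)
      + t * ((1 - t) * dist b y)\<^sup>2 - t * (1 - t) * (dist a y)\<^sup>2 = ((1 - t) * dist a b)\<^sup>2"
    by algebra
  finally have "(dist (geodesic_comb t a y) ?z)\<^sup>2 \<le> ((1 - t) * dist a b)\<^sup>2" by simp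
  then show ?thesis
    by (rule power2_le_imp_le) (use t in simp)
qed

text \<open>First the endpoint is moved at a fixed parameter, then the parameter along a fixed
  segment; both displacements tend to 0.\<close>

lemma tendsto_geodesic_comb:
  fixes a :: "'b \<Rightarrow> 'a::hadamard_space"
  assumes t: "(t \<longlongrightarrow> t0) F" and a: "(a \<longlongrightarrow> a0) F"
    and mem: "\<forall>\<^sub>F i in F. t i \<in> {0..1}" "t0 \<in> {0..1}"
  shows "((\<lambda>i. geodesic_comb (t i) (a i) y) \<longlongrightarrow> geodesic_comb t0 a0 y) F"
proof -
  have "((\<lambda>i. dist (a i) a0 + \<bar>t i - t0\<bar> * dist a0 y) \<longlongrightarrow> 0 + \<bar>t0 - t0\<bar> * dist a0 y) F"
    using a t by (intro tendsto_intros) (simp_all add: tendsto_dist_iff[symmetric])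
  then have lim: "((\<lambda>i. dist (a i) a0 + \<bar>t i - t0\<bar> * dist a0 y) \<longlongrightarrow> 0) F" by simp
  have "\<forall>\<^sub>F i in F. dist (geodesic_comb (t i) (a i) y) (geodesic_comb t0 a0 y)
      \<le> dist (a i) a0 + \<bar>t i - t0\<bar> * dist a0 y"
    using mem(1)
  proof eventually_elim
    case (elim i)
    have "dist (geodesic_comb (t i) (a i) y) (geodesic_comb t0 a0 y)
        \<le> dist (geodesic_comb (t i) (a i) y) (geodesic_comb (t i) a0 y)
          + dist (geodesic_comb (t i) a0 y) (geodesic_comb t0 a0 y)"
      by (rule dist_triangle)
    also have "\<dots> \<le> (1 - t i) * dist (a i) a0 + \<bar>t i - t0\<bar> * dist a0 y"
      using elim mem(2) dist_geodesic_comb_same_end[of "t i" "a i" y a0]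
        dist_geodesic_comb_geodesic_comb[of "t i" t0 a0 y] by auto
    also have "(1 - t i) * dist (a i) a0 \<le> dist (a i) a0"
      using elim by (intro mult_left_le_one_le) auto
    finally show ?case by simp
  qed
  then have "((\<lambda>i. dist (geodesic_comb (t i) (a i) y) (geodesic_comb t0 a0 y)) \<longlongrightarrow> 0) F"
    by (intro tendsto_sandwich[OF _ _ tendsto_const lim]) auto
  then show ?thesis by (subst tendsto_dist_iff)
qed

section \<open>Weak compactness\<close>

definition geodesically_convex :: "'a::hadamard_space set \<Rightarrow> bool" where
  "geodesically_convex C \<longleftrightarrow> (\<forall>x\<in>C. \<forall>y\<in>C. \<forall>t\<in>{0..1}. geodesic_comb t x y \<in> C)"

text \<open>Near-closest points to a centre \<open>c\<close> in suitable finite intersections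
  cluster, by the CAT(0) inequality at midpoints. Cantor's theorem on nested closed sets then gives
  one point, which turns out to lie in every member.\<close>

lemma hadamard_finite_intersection_property:
  fixes \<F> :: "'a::hadamard_space set set"
  assumes closed: "\<And>C. C \<in> \<F> \<Longrightarrow> closed C"
    and convex: "\<And>C. C \<in> \<F> \<Longrightarrow> geodesically_convex C"
    and B: "B \<in> \<F>" "bounded B"
    and fip: "\<And>\<A>. finite \<A> \<Longrightarrow> \<A> \<subseteq> \<F> \<Longrightarrow> \<Inter>\<A> \<noteq> {}"
  shows "\<Inter>\<F> \<noteq> {}"
proof -
  obtain c R where R: "B \<subseteq> cball c R"
    using B(2) bounded_subset_cball by blast
  \<comment> \<open>The supremum \<open>s\<close> is the largest distance from \<open>c\<close> to a
    finite intersection, as a limit. Negative radii belong to \<open>S\<close> through the empty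
    subfamily and the empty ball, and \<open>B\<close> bounds \<open>S\<close> above.\<close>
  define S where "S = {r. \<exists>\<A>. finite \<A> \<and> \<A> \<subseteq> \<F> \<and> \<Inter>\<A> \<inter> cball c r = {}}"
  define s where "s = Sup S"
  have neg: "r \<in> S" if "r < 0" for r
    unfolding S_def using that by (auto intro!: exI[of _ "{}"])
  have bound: "r \<le> R" if "r \<in> S" for r
  proof (rule ccontr)
    assume "\<not> r \<le> R"
    from that obtain \<A> where \<A>: "finite \<A>" "\<A> \<subseteq> \<F>" "\<Inter>\<A> \<inter> cball c r = {}"
      unfolding S_def by blast
    have "\<Inter>(insert B \<A>) \<noteq> {}" using \<A> B by (intro fip) auto
    then show False using \<A>(3) R \<open>\<not> r \<le> R\<close> by fastforce
  qed
  have bdd: "bdd_above S" by (rule bdd_aboveI) (rule bound)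
  have "S \<noteq> {}" using neg[of "-1"] by auto
  have "s \<ge> 0"
    by (rule dense_le) (auto simp: s_def intro!: cSup_upper bdd neg)
  have below: "\<exists>\<A>. finite \<A> \<and> \<A> \<subseteq> \<F> \<and> \<Inter>\<A> \<inter> cball c r = {}" if r: "r < s" for r
  proof -
    obtain r' where "r' \<in> S" "r < r'"
      using r less_cSup_iff[OF \<open>S \<noteq> {}\<close> bdd] by (auto simp: s_def)
    then obtain \<A> where "finite \<A>" "\<A> \<subseteq> \<F>" "\<Inter>\<A> \<inter> cball c r' = {}"
      unfolding S_def by blast
    moreover have "cball c r \<subseteq> cball c r'" using \<open>r < r'\<close> by auto
    ultimately show ?thesis by blast
  qed
  have above: "\<Inter>\<A> \<inter> cball c r \<noteq> {}" if "r > s" "finite \<A>" "\<A> \<subseteq> \<F>" for r \<A>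
    using that cSup_upper[OF _ bdd, of r] unfolding s_def S_def by fastforce
  define e where "e n = inverse (real (Suc n))" for n
  have e: "e n > 0" "e n \<le> 1" for n
    unfolding e_def by (auto simp: field_simps)
  have "\<forall>n. \<exists>\<A>. finite \<A> \<and> \<A> \<subseteq> \<F> \<and> \<Inter>\<A> \<inter> cball c (s - e n) = {}"
    using below e by simp
  then obtain \<A> where fin: "\<And>n. finite (\<A> n)" and sub: "\<And>n. \<A> n \<subseteq> \<F>"
    and disj: "\<And>n. \<Inter>(\<A> n) \<inter> cball c (s - e n) = {}"
    by metis
  \<comment> \<open>Collecting the subfamilies of all earlier stages makes \<open>K\<close>
    decreasing; the presence of the \<open>n\<close>-th one confines \<open>K n\<close> to distances
    between \<open>s - e n\<close> and \<open>s + e n\<close> from \<open>c\<close>.\<close>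
  define K where "K n = \<Inter>(\<Union>k\<le>n. \<A> k) \<inter> cball c (s + e n)" for n
  have K_closed: "closed (K n)" for n
    unfolding K_def using closed sub by (intro closed_Int closed_Inter closed_cball) auto
  have K_meets: "K n \<inter> C \<noteq> {}" if "C \<in> \<F>" for n C
  proof -
    have "\<Inter>(insert C (\<Union>k\<le>n. \<A> k)) \<inter> cball c (s + e n) \<noteq> {}"
      using that fin sub e by (intro above) auto
    then show ?thesis unfolding K_def by auto
  qed
  have K_mono: "K n \<subseteq> K m" if "m \<le> n" for m n
  proof -
    have "e n \<le> e m" using that by (auto simp: e_def intro!: le_imp_inverse_le)
    then show ?thesis using that unfolding K_def by fastforce
  qed
  have K_diam: "\<exists>n. \<forall>x\<in>K n. \<forall>y\<in>K n. dist x y < \<epsilon>" if \<epsilon>: "\<epsilon> > 0" for \<epsilon>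
  proof -
    \<comment> \<open>The constant anticipates the bound \<open>4 * (2 * e n * (2 * s + 1))\<close>
      for the squared distance of two points of \<open>K n\<close>.\<close>
    have "\<epsilon>\<^sup>2 / (8 * (2 * s + 1)) > 0" using \<epsilon> \<open>s \<ge> 0\<close> by simp
    then obtain n where n: "e n < \<epsilon>\<^sup>2 / (8 * (2 * s + 1))"
      unfolding e_def using reals_Archimedean by blast
    have "dist x y < \<epsilon>" if xy: "x \<in> K n" "y \<in> K n" for x y
    proof -
      let ?m = "geodesic_comb (1/2) x y"
      \<comment> \<open>The radius \<open>s - e n\<close> may be negative; truncation at 0 allows
        squaring.\<close>
      define u where "u = max 0 (s - e n)"
      have "?m \<in> \<Inter>(\<A> n)"
      proof
        fix C assume C: "C \<in> \<A> n"
        then have "x \<in> C" "y \<in> C" using xy unfolding K_def by auto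
        moreover have "geodesically_convex C" using C sub by (intro convex) auto
        ultimately show "?m \<in> C" by (simp add: geodesically_convex_def)
      qed
      then have "u \<le> dist ?m c" using disj[of n] unfolding u_def
        by (auto simp: dist_commute disjoint_iff)
      then have "u\<^sup>2 \<le> (dist ?m c)\<^sup>2" by (intro power_mono) (auto simp: u_def)
      also have "\<dots> \<le> 1/2 * (dist x c)\<^sup>2 + 1/2 * (dist y c)\<^sup>2 - 1/4 * (dist x y)\<^sup>2"
        using CAT0_geodesic_comb[of "1/2" x y c] by simp
      finally have "(dist x y)\<^sup>2 \<le> 2 * (dist x c)\<^sup>2 + 2 * (dist y c)\<^sup>2 - 4 * u\<^sup>2" by simp
      moreover have "(dist x c)\<^sup>2 \<le> (s + e n)\<^sup>2" "(dist y c)\<^sup>2 \<le> (s + e n)\<^sup>2"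
        using xy unfolding K_def by (auto simp: dist_commute intro!: power_mono)
      ultimately have "(dist x y)\<^sup>2 \<le> 4 * ((s + e n)\<^sup>2 - u\<^sup>2)" by simp
      also have "\<dots> = 4 * ((s + e n - u) * (s + e n + u))"
        by algebra
      also have "\<dots> \<le> 4 * (2 * e n * (2 * s + 1))"
        using e[of n] \<open>s \<ge> 0\<close> by (intro mult_left_mono mult_mono) (auto simp: u_def)
      also have "\<dots> < \<epsilon>\<^sup>2" using n \<open>s \<ge> 0\<close> by (simp add: field_simps)
      finally show ?thesis using \<epsilon> by (intro power2_less_imp_less[of _ \<epsilon>]) auto
    qed
    then show ?thesis by blast
  qed
  have "\<exists>p. \<Inter>(range K) = {p}"
  proof (rule decreasing_closed_nest_sing)
    show "K n \<noteq> {}" for n using K_meets[OF B(1), of n] by blast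
  qed (fact K_closed K_mono K_diam)+
  then obtain p where p: "\<Inter>(range K) = {p}" by blast
  have "p \<in> C" if C: "C \<in> \<F>" for C
  proof -
    \<comment> \<open>Intersecting with \<open>C\<close> preserves nestedness and shrinking
      diameters; the resulting point lies in all \<open>K n\<close>, hence equals
      \<open>p\<close>.\<close>
    have "\<exists>a. \<Inter>(range (\<lambda>n. K n \<inter> C)) = {a}"
    proof (rule decreasing_closed_nest_sing)
      show "closed (K n \<inter> C)" for n using K_closed closed[OF C] by blast
      show "K n \<inter> C \<noteq> {}" for n by (rule K_meets[OF C])
      show "K n \<inter> C \<subseteq> K m \<inter> C" if "m \<le> n" for m n using K_mono[OF that] by blast
      show "\<exists>n. \<forall>x\<in>K n \<inter> C. \<forall>y\<in>K n \<inter> C. dist x y < \<epsilon>" if "\<epsilon> > 0" for \<epsilon>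
        using K_diam[OF that] by blast
    qed
    then obtain a where "\<And>n. a \<in> K n \<inter> C" by blast
    then have "a \<in> \<Inter>(range K)" "a \<in> C" by auto
    then show ?thesis using p by simp
  qed
  then show ?thesis by blast
qed

section \<open>Strongly quasiconvex functions\<close>

lemma strongly_quasiconvexD:
  assumes "strongly_quasiconvex \<gamma> h" "0 \<le> t" "t \<le> 1"
  shows "h (geodesic_comb t x y) \<le> max (h x) (h y) - t * (1 - t) * (\<gamma> / 2) * (dist x y)\<^sup>2"
  using assms by (auto simp: strongly_quasiconvex_def)

lemma strongly_quasiconvex_le_max:
  assumes "strongly_quasiconvex \<gamma> h" "0 \<le> t" "t \<le> 1"
  shows "h (geodesic_comb t x y) \<le> max (h x) (h y)"
proof -
  have "0 \<le> t * (1 - t) * (\<gamma> / 2) * (dist x y)\<^sup>2"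
    using assms by (simp add: strongly_quasiconvex_def)
  then show ?thesis using strongly_quasiconvexD[OF assms, of x y] by linarith
qed

lemma closed_sublevel:
  assumes "lower_semicontinuous h"
  shows "closed {x. h x \<le> c}"
proof -
  have "open {x. c < h x}"
  proof (subst open_subopen, clarify)
    fix x assume "c < h x"
    then have "\<forall>\<^sub>F z in nhds x. c < h z"
      using assms by (simp add: lower_semicontinuous_def)
    then show "\<exists>T. open T \<and> x \<in> T \<and> T \<subseteq> {x. c < h x}"
      unfolding eventually_nhds by auto
  qed
  then show ?thesis by (simp add: closed_def Collect_neg_eq[symmetric] not_le)
qed

lemma geodesically_convex_sublevel:
  assumes "strongly_quasiconvex \<gamma> h"
  shows "geodesically_convex {x. h x \<le> c}"
  unfolding geodesically_convex_def
proof safe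
  fix x y and t :: real assume "h x \<le> c" "h y \<le> c" and t: "t \<in> {0..1}"
  then show "h (geodesic_comb t x y) \<le> c"
    using strongly_quasiconvex_le_max[OF assms, of t x y] by auto
qed

text \<open>Along a long segment from \<open>y\<close>, the function is already very negative at a fixed distance from
  \<open>y\<close>, which lower semicontinuity at \<open>y\<close> prevents.\<close>

lemma bounded_sublevel:
  fixes h :: "'a::hadamard_space \<Rightarrow> real"
  assumes h: "strongly_quasiconvex \<gamma> h" "lower_semicontinuous h"
  shows "bounded {x. h x \<le> h y}"
proof -
  have "\<gamma> > 0" using h(1) by (simp add: strongly_quasiconvex_def)
  have "\<forall>\<^sub>F z in nhds y. h y - 1 < h z"
    using h(2) by (simp add: lower_semicontinuous_def)
  then obtain \<delta> where \<delta>: "\<delta> > 0" "\<And>z. dist z y < \<delta> \<Longrightarrow> h y - 1 < h z"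
    unfolding eventually_nhds_metric by blast
  have "dist y x \<le> max \<delta> (8 / (\<delta> * \<gamma>))" if x: "h x \<le> h y" for x
  proof (cases "dist y x \<le> \<delta>")
    case False
    define d where "d = dist y x"
    \<comment> \<open>This places \<open>?z\<close> at distance \<open>\<delta> / 2\<close> from
      \<open>y\<close>, with \<open>1 - t\<close> at least \<open>1/2\<close>.\<close>
    define t where "t = \<delta> / (2 * d)"
    have d: "d > \<delta>" "d > 0" using False \<delta> by (auto simp: d_def)
    have t: "0 \<le> t" "t \<le> 1/2" "t * d = \<delta> / 2" using d \<delta> by (auto simp: t_def field_simps)
    let ?z = "geodesic_comb t y x"
    have "dist ?z y = t * d"
      using t by (subst dist_commute) (simp add: dist_geodesic_comb_left d_def)
    then have "dist ?z y < \<delta>" using t(3) \<delta>(1) by simp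
    then have "h y - 1 < h ?z" by (rule \<delta>)
    also have "h ?z \<le> h y - t * (1 - t) * (\<gamma> / 2) * d\<^sup>2"
      using strongly_quasiconvexD[OF h(1), of t y x] t x by (simp add: d_def)
    finally have "t * (1 - t) * (\<gamma> / 2) * d\<^sup>2 < 1" by simp
    moreover have "t * (1 - t) * (\<gamma> / 2) * d\<^sup>2 = (t * d) * d * (\<gamma> / 2) * (1 - t)" by algebra
    moreover have "(t * d) * d * (\<gamma> / 2) * (1 - t) \<ge> (t * d) * d * (\<gamma> / 2) * (1 / 2)"
      using t d \<delta> \<open>\<gamma> > 0\<close> by (intro mult_left_mono) auto
    ultimately have "\<delta> / 2 * d * (\<gamma> / 2) * (1 / 2) < 1" unfolding t(3) by linarith
    then have "d \<le> 8 / (\<delta> * \<gamma>)" using \<delta> \<open>\<gamma> > 0\<close> by (simp add: field_simps)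
    then show ?thesis by (simp add: d_def)
  qed simp
  then show ?thesis unfolding bounded_def by blast
qed

section \<open>Equilibrium problems\<close>

text \<open>Independent parameters in the unit interval replace barycentric weights, so the domain
  is a cube rather than a simplex.\<close>

fun iterated_comb :: "(nat \<Rightarrow> 'a::hadamard_space) \<Rightarrow> (nat \<Rightarrow> real) \<Rightarrow> nat \<Rightarrow> 'a" where
  "iterated_comb y t 0 = y 0"
| "iterated_comb y t (Suc k) = geodesic_comb (t k) (iterated_comb y t k) (y (Suc k))"

lemma continuous_on_iterated_comb:
  "continuous_on unit_cube (\<lambda>t. iterated_comb y t k)"
proof (induction k)
  case (Suc k)
  have "continuous_on unit_cube (\<lambda>t. t k :: real)"
    by (rule continuous_on_product_then_coordinatewise[OF continuous_on_id])
  with Suc show ?case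
    unfolding continuous_on_def
    by (auto intro!: tendsto_geodesic_comb simp: eventually_at_filter unit_cube_def)
qed simp

lemma finite_dual_solution:
  fixes f :: "'a::hadamard_space \<Rightarrow> 'a \<Rightarrow> real" and y :: "nat \<Rightarrow> 'a"
  assumes diag: "\<And>x. f x x = 0"
    and lsc: "\<And>x. lower_semicontinuous (f x)"
    and pm: "pseudomonotone f"
    and sq: "\<And>x. strongly_quasiconvex \<gamma> (f x)"
  shows "\<exists>x. \<forall>i\<le>n. f (y i) x \<le> 0"
proof -
  define D where "D i = {x. f (y i) x \<le> 0}" for i
  have D: "closed (D i)" "D i \<noteq> {}" for i
    using closed_sublevel[OF lsc] diag by (auto simp: D_def intro!: exI[of _ "y i"])
  define g where "g i t = infdist (iterated_comb y t n) (D i)" for i t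
  define G where "G k t = (\<Sum>i\<le>k. g i t)" for k t
  have g_nonneg: "g i t \<ge> 0" for i t unfolding g_def by (rule infdist_nonneg)
  have G_nonneg: "G k t \<ge> 0" for k t unfolding G_def by (intro sum_nonneg g_nonneg)
  have G_Suc: "G (Suc k) t = G k t + g (Suc k) t" for k t unfolding G_def by simp
  have g_cont: "continuous_on unit_cube (g i)" for i
    unfolding g_def by (intro continuous_intros continuous_on_iterated_comb)
  \<comment> \<open>A zero says that \<open>t k\<close> is the share of \<open>g (Suc k) t\<close>
    in the partial sum \<open>G (Suc k) t\<close>. The form without division stays continuous where
    the sum vanishes.\<close>
  define F where "F k t = t k * G (Suc k) t - g (Suc k) t" for k t
  have "\<exists>t\<in>unit_cube. \<forall>k<n. F k t = 0"
  proof (rule Poincare_Miranda[of n F])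
    show "continuous_on unit_cube (F k)" for k
      unfolding F_def G_def
      by (intro continuous_intros g_cont continuous_on_product_then_coordinatewise[OF continuous_on_id])
    show "F k t \<le> 0" if "t k = 0" for k t using that g_nonneg by (simp add: F_def)
    show "F k t \<ge> 0" if "t k = 1" for k t using that G_nonneg by (simp add: F_def G_Suc)
  qed blast
  then obtain t where t: "t \<in> unit_cube" and t_eq: "\<And>k. k < n \<Longrightarrow> F k t = 0"
    by blast
  define w where "w = iterated_comb y t n"
  have g_pos: "f w (y i) < 0" if "g i t > 0" for i
  proof -
    have "w \<notin> D i" using that unfolding g_def w_def by (auto dest: infdist_zero)
    then have "\<not> f (y i) w \<le> 0" by (simp add: D_def)
    then show ?thesis using pm unfolding pseudomonotone_def by (meson not_le)
  qed
  \<comment> \<open>Only endpoints that carry weight matter: given \<open>G (Suc k) t > 0\<close>,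
    \<open>t k < 1\<close> forces \<open>G k t > 0\<close>, and \<open>t k > 0\<close> forces
    \<open>g (Suc k) t > 0\<close>. At \<open>k = n\<close> the point is \<open>w\<close> itself, so
    \<open>G n t > 0\<close> would contradict \<open>f w w = 0\<close>.\<close>
  have neg: "f w (iterated_comb y t k) < 0" if "k \<le> n" "G k t > 0" for k
    using that
  proof (induction k)
    case 0
    then show ?case using g_pos[of 0] by (simp add: G_def)
  next
    case (Suc k)
    have tk: "0 \<le> t k" "t k \<le> 1" using t by (auto simp: unit_cube_def)
    have eq: "g (Suc k) t = t k * G (Suc k) t" "G k t = (1 - t k) * G (Suc k) t"
      using t_eq[of k] Suc.prems G_Suc[of k t] by (auto simp: F_def algebra_simps)
    have left: "f w (iterated_comb y t k) < 0" if "t k < 1"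
      using Suc eq(2) that by simp
    have right: "f w (y (Suc k)) < 0" if "t k > 0"
      using Suc.prems eq(1) that by (intro g_pos) simp
    consider "t k = 0" | "t k = 1" | "0 < t k" "t k < 1" using tk by linarith
    then show ?case
    proof cases
      case 3
      then show ?thesis
        using left right strongly_quasiconvex_le_max[OF sq tk, of w "iterated_comb y t k" "y (Suc k)"]
        by simp
    qed (use left right in auto)
  qed
  have "G n t = 0"
    using neg[of n] diag[of w] G_nonneg[of n t] by (force simp: w_def[symmetric])
  then have "g i t = 0" if "i \<le> n" for i
    using that unfolding G_def by (subst (asm) sum_nonneg_eq_0_iff) (auto simp: g_nonneg)
  then have "w \<in> D i" if "i \<le> n" for i
    using that D in_closed_iff_infdist_zero[of "D i" w] by (simp add: g_def w_def)
  then show ?thesis by (auto simp: D_def)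
qed

text \<open>A Minty-type argument: if \<open>f x y < 0\<close>, then also \<open>f z y < 0\<close>
  at a point \<open>z\<close> of the segment close to \<open>x\<close>, while \<open>f z x\<close>
  is at most 0. Strong quasiconvexity then makes \<open>f z z\<close> negative.\<close>

lemma dual_solution_imp_solution:
  fixes f :: "'a::hadamard_space \<Rightarrow> 'a \<Rightarrow> real"
  assumes diag: "\<And>x. f x x = 0"
    and usc: "\<And>y. upper_semicontinuous (\<lambda>x. f x y)"
    and sq: "\<And>x. strongly_quasiconvex \<gamma> (f x)"
    and x: "\<And>y. f y x \<le> 0"
  shows "0 \<le> f x y"
proof (rule ccontr)
  assume neg: "\<not> 0 \<le> f x y"
  then have "x \<noteq> y" using diag by auto
  have "\<gamma> > 0" using sq by (simp add: strongly_quasiconvex_def)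
  have "\<forall>\<^sub>F z in nhds x. f z y < 0"
    using usc[of y] neg by (simp add: upper_semicontinuous_def)
  then obtain \<delta> where \<delta>: "\<delta> > 0" "\<And>z. dist z x < \<delta> \<Longrightarrow> f z y < 0"
    unfolding eventually_nhds_metric by blast
  define t where "t = min (1/2) (\<delta> / (2 * dist x y))"
  have t: "0 < t" "t < 1" and "t * dist x y \<le> \<delta> / 2"
    using \<delta> \<open>x \<noteq> y\<close> by (auto simp: t_def min_def field_simps)
  define z where "z = geodesic_comb t x y"
  have "dist z x < \<delta>"
    using dist_geodesic_comb_left[of t x y] t \<open>t * dist x y \<le> \<delta> / 2\<close> \<delta>
    by (simp add: z_def dist_commute)
  then have "f z y < 0" by (rule \<delta>)
  have "0 \<le> max (f z x) (f z y) - t * (1 - t) * (\<gamma> / 2) * (dist x y)\<^sup>2"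
    using strongly_quasiconvexD[OF sq, of t z x y] diag[of z] t by (simp add: z_def)
  moreover have "t * (1 - t) * (\<gamma> / 2) * (dist x y)\<^sup>2 > 0"
    using t \<open>\<gamma> > 0\<close> \<open>x \<noteq> y\<close> by simp
  ultimately show False using x[of z] \<open>f z y < 0\<close> by linarith
qed

theorem theorem3p9:
  fixes f :: "'a::hadamard_space \<Rightarrow> 'a \<Rightarrow> real"
  assumes "\<And>x. f x x = 0"
    and "\<And>x. lower_semicontinuous (\<lambda>y. f x y)"
    and "\<And>y. upper_semicontinuous (\<lambda>x. f x y)"
    and "pseudomonotone f"
    and "\<exists>\<gamma>>0. \<forall>x. strongly_quasiconvex \<gamma> (\<lambda>y. f x y)"
  shows "equilibrium_solutions f \<noteq> {}"
proof -
  obtain \<gamma> where sq: "\<And>x. strongly_quasiconvex \<gamma> (f x)" using assms(5) by auto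
  define D where "D y = {x. f y x \<le> 0}" for y
  have "\<Inter>(range D) \<noteq> {}"
  proof (rule hadamard_finite_intersection_property)
    show "D undefined \<in> range D" by simp
    \<comment> \<open>As \<open>f\<close> vanishes on the diagonal, 0 is the value of
      \<open>f undefined\<close> at \<open>undefined\<close> itself, the level that
      \<open>bounded_sublevel\<close> treats.\<close>
    show "bounded (D undefined)"
      using bounded_sublevel[OF sq assms(2), of undefined undefined] assms(1) by (simp add: D_def)
    show "closed C" "geodesically_convex C" if "C \<in> range D" for C
      using that closed_sublevel[OF assms(2)] geodesically_convex_sublevel[OF sq]
      by (auto simp: D_def)
    show "\<Inter>\<A> \<noteq> {}" if \<A>: "finite \<A>" "\<A> \<subseteq> range D" for \<A>
    proof -
      obtain Y where Y: "finite Y" "\<A> = D ` Y"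
        using finite_subset_image[OF \<A>] by blast
      obtain ys where ys: "set ys = Y" using finite_list[OF Y(1)] by blast
      \<comment> \<open>Indices run up to and including \<open>length ys\<close>, so an arbitrary
        last point is appended; this also covers an empty list.\<close>
      obtain x where "\<forall>i\<le>length ys. f ((ys @ [undefined]) ! i) x \<le> 0"
        using finite_dual_solution[OF assms(1,2,4) sq, of "length ys" "\<lambda>i. (ys @ [undefined]) ! i"]
        by blast
      then have "f (ys ! i) x \<le> 0" if "i < length ys" for i
        using that by (metis less_imp_le nth_append_left)
      then have "x \<in> D y" if "y \<in> Y" for y
        using that unfolding ys[symmetric] in_set_conv_nth D_def by auto
      then show ?thesis using Y(2) by blast
    qed
  qed
  then obtain x where "\<And>y. f y x \<le> 0" by (auto simp: D_def)
  then have "\<And>y. 0 \<le> f x y" using dual_solution_imp_solution[OF assms(1,3) sq] by blast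
  then show ?thesis by (auto simp: equilibrium_solutions_def)
qed

end
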